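(* Let $\Omega$ be a finite set, let $f=(f_1,\dots,f_n):\Omega\to\mathbf{R}^n$ be a feature function with $f_i(\omega)\ge 0$ for all $i$ and all $\omega\in\Omega$, and let $\tilde p,q_0\in\Delta$ satisfy $\tilde p\ll q_0$. Let $q^{(k)}$, $k\ge 0$, be a sequence in $\Delta$ determined by the Improved Iterative Scaling algorithm: $q^{(0)}=q_0$ and, for each $k\ge 0$, $q^{(k+1)}=\gamma^{(k)}\circ q^{(k)}$, where for each $i$ the component $\gamma^{(k)}_i\in[-\infty,\infty)$ is a solution of $$\sum_{\omega\in\Omega} q^{(k)}(\omega)\, f_i(\omega)\, e^{\gamma_i^{(k)} f_\#(\omega)}=\sum_{\omega\in\Omega}\tilde p(\omega) f_i(\omega).$$ Then $D(\tilde p\,\|\,q^{(k)})$ decreases monotonically to $D(\tilde p\,\|\,q_\star)$ and $q^{(k)}$ converges to $q_\star$, where $$q_\star=\arg\min_{q\in\bar{\mathcal Q}}D(\tilde p\,\|\,q)=\arg\min_{p\in\mathcal P}D(p\,\|\,q_0).$$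
   Context: $\Delta$ is the simplex of all probability distributions on the finite set $\Omega$, with the topology inherited from Euclidean space. For $p\in\Delta$ and a (vector-valued) function $g$ on $\Omega$, $p[g]=\sum_\omega p(\omega)g(\omega)$. $D(p\,\|\,q)=\sum_\omega p(\omega)\log\frac{p(\omega)}{q(\omega)}\in[0,\infty]$ is the Kullback-Leibler divergence (with $0\log 0=0$, and value $+\infty$ if $p(\omega)>0=q(\omega)$ for some $\omega$). $\tilde p\ll q_0$ means $\tilde p(\omega)=0$ whenever $q_0(\omega)=0$; equivalently $D(\tilde p\,\|\,q_0)<\infty$. $f_\#(\omega)=\sum_{i=1}^n f_i(\omega)$. For $q\in\Delta$ and $\gamma\in[-\infty,\infty)^n$, $(\gamma\circ q)(\omega)=\frac1Z e^{\gamma\cdot f(\omega)}q(\omega)$, where $\gamma\cdot f(\omega)=\sum_i\gamma_i f_i(\omega)$, $Z=\sum_\omega e^{\gamma\cdot f(\omega)}q(\omega)$ is the normalizing constant (required to be nonzero), and the conventions $e^{-\infty}=0$ and $(-\infty)\cdot 0=0$ are used. $\mathcal P=\{p\in\Delta: p[f]=\tilde p[f]\}$, $\mathcal Q=\{\lambda\circ q_0:\lambda\in\mathbf{R}^n\}$, and $\bar{\mathcal Q}$ is the closure of $\mathcal Q$ in $\Delta$. "Decreases monotonically" is meant in the weak (non-increasing) sense. If $f_i$ is not identically zero on the support of $q^{(k)}$, the equation for $\gamma_i^{(k)}$ has a unique solution; otherwise every value in $[-\infty,\infty)$ is a solution and the choice does not affect $q^{(k+1)}$. *)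

theory Defs
  imports "HOL-Analysis.Analysis"
begin

definition prob_simplex :: "(real ^ 'w::finite) set" where
  "prob_simplex = {p. (\<forall>\<omega>. 0 \<le> p $ \<omega>) \<and> (\<Sum>\<omega>\<in>UNIV. p $ \<omega>) = 1}"

definition mean :: "real ^ 'w::finite \<Rightarrow> ('w \<Rightarrow> 'b::real_vector) \<Rightarrow> 'b" where
  "mean p g = (\<Sum>\<omega>\<in>UNIV. p $ \<omega> *\<^sub>R g \<omega>)"

(* No summand is -\<infinity>, so the sum in ereal never meets \<infinity> + (-\<infinity>). *)
definition KL_div :: "real ^ 'w::finite \<Rightarrow> real ^ 'w \<Rightarrow> ereal" where
  "KL_div p q = (\<Sum>\<omega>\<in>UNIV. if p $ \<omega> = 0 then 0
                        else if q $ \<omega> = 0 then \<infinity>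
                        else ereal (p $ \<omega> * ln (p $ \<omega> / q $ \<omega>)))"

(* Intended for exponents in [-\<infinity>,\<infinity>); the value at \<infinity> is arbitrary. *)
definition exp_ext :: "ereal \<Rightarrow> real" where
  "exp_ext x = (if x = -\<infinity> then 0 else exp (real_of_ereal x))"

(* Multiplication on ereal already satisfies (-\<infinity>) * 0 = 0.  With nonnegative features
   and \<gamma> $ i \<noteq> \<infinity>, and also with finite \<gamma>, the sum contains no \<infinity>. *)
definition lin_comb :: "('w \<Rightarrow> real ^ 'n::finite) \<Rightarrow> ereal ^ 'n \<Rightarrow> 'w \<Rightarrow> ereal" where
  "lin_comb f \<gamma> \<omega> = (\<Sum>i\<in>UNIV. \<gamma> $ i * ereal (f \<omega> $ i))"

definition norm_const ::
    "('w::finite \<Rightarrow> real ^ 'n::finite) \<Rightarrow> ereal ^ 'n \<Rightarrow> real ^ 'w \<Rightarrow> real" where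
  "norm_const f \<gamma> q = (\<Sum>\<omega>\<in>UNIV. exp_ext (lin_comb f \<gamma> \<omega>) * q $ \<omega>)"

(* The distribution \<gamma> \<circ> q; meaningful only if norm_const f \<gamma> q \<noteq> 0. *)
definition tilt ::
    "('w::finite \<Rightarrow> real ^ 'n::finite) \<Rightarrow> ereal ^ 'n \<Rightarrow> real ^ 'w \<Rightarrow> real ^ 'w" where
  "tilt f \<gamma> q = (\<chi> \<omega>. 1 / norm_const f \<gamma> q * exp_ext (lin_comb f \<gamma> \<omega>) * q $ \<omega>)"

definition feature_total :: "('w \<Rightarrow> real ^ 'n::finite) \<Rightarrow> 'w \<Rightarrow> real" where
  "feature_total f \<omega> = (\<Sum>i\<in>UNIV. f \<omega> $ i)"

definition linear_family ::
    "('w::finite \<Rightarrow> real ^ 'n::finite) \<Rightarrow> real ^ 'w \<Rightarrow> (real ^ 'w) set" where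
  "linear_family f pt = {p \<in> prob_simplex. mean p f = mean pt f}"

definition exp_family ::
    "('w::finite \<Rightarrow> real ^ 'n::finite) \<Rightarrow> real ^ 'w \<Rightarrow> (real ^ 'w) set" where
  "exp_family f q0 = range (\<lambda>l :: real ^ 'n. tilt f (\<chi> i. ereal (l $ i)) q0)"

definition exp_family_closure ::
    "('w::finite \<Rightarrow> real ^ 'n::finite) \<Rightarrow> real ^ 'w \<Rightarrow> (real ^ 'w) set" where
  "exp_family_closure f q0 = top_of_set prob_simplex closure_of exp_family f q0"

(* q is a run of Improved Iterative Scaling with target pt and start q0, and \<gamma> k is the
   update chosen at step k.  Where the scaling equation has several solutions, any choice
   is admitted. *)
definition IIS_run ::
    "('w::finite \<Rightarrow> real ^ 'n::finite) \<Rightarrow> real ^ 'w \<Rightarrow> real ^ 'w \<Rightarrow>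
     (nat \<Rightarrow> ereal ^ 'n) \<Rightarrow> (nat \<Rightarrow> real ^ 'w) \<Rightarrow> bool" where
  "IIS_run f pt q0 \<gamma> q \<longleftrightarrow>
     q 0 = q0 \<and> (\<forall>k. q k \<in> prob_simplex) \<and>
     (\<forall>k i. \<gamma> k $ i \<noteq> \<infinity> \<and>
        (\<Sum>\<omega>\<in>UNIV. q k $ \<omega> * f \<omega> $ i * exp_ext (\<gamma> k $ i * ereal (feature_total f \<omega>)))
          = (\<Sum>\<omega>\<in>UNIV. pt $ \<omega> * f \<omega> $ i)) \<and>
     (\<forall>k. norm_const f (\<gamma> k) (q k) \<noteq> 0 \<and> q (Suc k) = tilt f (\<gamma> k) (q k))"

end

theory Submission
  imports Defs
begin

text \<open>
  If \<open>s\<close> lies in both \<open>\<P>\<close> and the closure of \<open>\<Q>\<close>, the Pythagorean identity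
  \<open>D(p \<parallel> r) = D(p \<parallel> s) + D(s \<parallel> r)\<close> holds for \<open>p \<in> \<P>\<close> with \<open>p \<lless> q\<^sub>0\<close> and \<open>r\<close> in the closure of
  \<open>\<Q>\<close>, because for \<open>r \<in> \<Q>\<close> the value \<open>D(p \<parallel> r) - D(p \<parallel> q\<^sub>0)\<close> depends on \<open>p\<close> only through \<open>p[f]\<close>.
  Hence \<open>s\<close> is unique and solves both minimisation problems. Convexity of \<open>exp\<close>, with weights
  \<open>f\<^sub>i / f\<^sub>#\<close>, shows that an IIS step lowers the divergence by at least
  \<open>\<Sum>\<^sub>i \<Sum>\<^sub>\<omega> q(\<omega>) (f\<^sub>i(\<omega>) / f\<^sub>#(\<omega>)) \<psi>(u\<^sub>i(\<omega>))\<close>, where \<open>u\<^sub>i = exp (\<gamma>\<^sub>i f\<^sub>#)\<close> and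
  \<open>\<psi>(u) = u ln u - u + 1 \<ge> (\<surd>u - 1)\<^sup>2\<close>. These decrements tend to 0, and the scaling equation then
  forces \<open>q\<^sub>k[f]\<close> to tend to \<open>p[f]\<close> for the target \<open>p\<close>: every limit point of the run lies in \<open>\<P>\<close> and in the
  closure of \<open>\<Q>\<close>, so it is \<open>s\<close>.
\<close>

section \<open>A logarithm inequality and the compactness of the simplex\<close>

text \<open>This is \<open>ln t \<le> t - 1\<close> at \<open>t = sqrt (b / a)\<close>, multiplied
  by \<open>2 * a\<close>. The square left over beyond \<open>a - b\<close> yields both the equality
  case of the divergence and the gap estimate for the algorithm.\<close>

lemma mult_ln_ratio_ge:
  fixes a b :: real
  assumes "0 \<le> a" "0 \<le> b" "b = 0 \<Longrightarrow> a = 0"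
  shows "a - b + (sqrt a - sqrt b)\<^sup>2 \<le> a * ln (a / b)"
proof (cases "a = 0")
  case True
  then show ?thesis using assms by simp
next
  case False
  then have a: "a > 0" and b: "b > 0" using assms by force+
  have "ln (sqrt (b / a)) \<le> sqrt (b / a) - 1"
    using a b by (intro ln_le_minus_one) simp
  moreover have "ln (sqrt (b / a)) = - ln (a / b) / 2"
    using a b by (simp add: ln_sqrt ln_div)
  ultimately have "2 * a - 2 * (a * sqrt (b / a)) \<le> a * ln (a / b)"
    using mult_left_mono[of "2 - 2 * sqrt (b / a)" "ln (a / b)" a] a
    by (simp add: algebra_simps)
  moreover have "a * sqrt (b / a) = sqrt a * sqrt b"
    using a b by (simp add: real_sqrt_divide field_simps)
  moreover have "(sqrt a - sqrt b)\<^sup>2 = a + b - 2 * (sqrt a * sqrt b)"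
    using a b by (simp add: power2_diff)
  ultimately show ?thesis by simp
qed

lemma prob_simplex_nonneg: "p \<in> prob_simplex \<Longrightarrow> 0 \<le> p $ \<omega>"
  and prob_simplex_sum: "p \<in> prob_simplex \<Longrightarrow> (\<Sum>\<omega>\<in>UNIV. p $ \<omega>) = 1"
  by (auto simp: prob_simplex_def)

lemma prob_simplex_le_1: "p \<in> prob_simplex \<Longrightarrow> p $ \<omega> \<le> 1"
  using member_le_sum[of \<omega> UNIV "\<lambda>\<omega>. p $ \<omega>"]
  by (auto simp: prob_simplex_def)

lemma prob_simplex_ex_pos:
  assumes "p \<in> prob_simplex"
  obtains \<omega> where "0 < p $ \<omega>"
proof -
  have "\<exists>\<omega>. 0 < p $ \<omega>"
  proof (rule ccontr)
    assume "\<nexists>\<omega>. 0 < p $ \<omega>"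
    then have "(\<Sum>\<omega>\<in>UNIV. p $ \<omega>) \<le> 0"
      by (intro sum_nonpos) (auto simp: not_less)
    then show False using prob_simplex_sum[OF assms] by simp
  qed
  then show ?thesis using that by blast
qed

lemma compact_prob_simplex: "compact (prob_simplex :: (real ^ 'w::finite) set)"
proof -
  have "norm p \<le> 1" if "p \<in> prob_simplex" for p :: "real ^ 'w"
    using norm_le_l1_cart[of p] that by (simp add: prob_simplex_def)
  then have "bounded (prob_simplex :: (real ^ 'w) set)"
    by (auto simp: bounded_iff)
  moreover have "closed (prob_simplex :: (real ^ 'w) set)"
    unfolding prob_simplex_def
    by (intro closed_Collect_conj closed_Collect_all closed_Collect_le closed_Collect_eq
        continuous_intros)
  ultimately show ?thesis by (simp add: compact_eq_bounded_closed)
qed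

section \<open>Kullback-Leibler divergence and its continuity\<close>

text \<open>A stand-in for \<open>KL_div\<close> in real arithmetic, faithful only if
  \<open>p\<close> vanishes wherever \<open>q\<close> does; otherwise division by zero puts a
  default value in place of \<infinity>.\<close>

definition KL_real :: "real ^ 'w::finite \<Rightarrow> real ^ 'w \<Rightarrow> real" where
  "KL_real p q = (\<Sum>\<omega>\<in>UNIV. p $ \<omega> * ln (p $ \<omega> / q $ \<omega>))"

lemma KL_div_eq_KL_real:
  assumes "\<And>\<omega>. q $ \<omega> = 0 \<Longrightarrow> p $ \<omega> = 0"
  shows "KL_div p q = ereal (KL_real p q)"
  unfolding KL_div_def KL_real_def sum_ereal[symmetric]
  by (rule sum.cong) (use assms in auto)

lemma KL_div_eq_infinity:
  assumes "p $ \<omega> \<noteq> 0" "q $ \<omega> = 0"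
  shows "KL_div p q = \<infinity>"
  unfolding KL_div_def using assms by (auto simp: sum_Pinfty)

text \<open>Both masses are 1, so the linear terms of the pointwise inequality cancel in the sum.
  What remains is the squared Hellinger distance up to a constant factor.\<close>

lemma KL_real_ge:
  assumes "p \<in> prob_simplex" "q \<in> prob_simplex" "\<And>\<omega>. q $ \<omega> = 0 \<Longrightarrow> p $ \<omega> = 0"
  shows "(\<Sum>\<omega>\<in>UNIV. (sqrt (p $ \<omega>) - sqrt (q $ \<omega>))\<^sup>2) \<le> KL_real p q"
proof -
  have "(\<Sum>\<omega>\<in>UNIV. p $ \<omega> - q $ \<omega> + (sqrt (p $ \<omega>) - sqrt (q $ \<omega>))\<^sup>2) \<le> KL_real p q"
    unfolding KL_real_def
    by (intro sum_mono mult_ln_ratio_ge) (use assms prob_simplex_nonneg in auto)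
  then show ?thesis
    using assms by (simp add: sum.distrib sum_subtractf prob_simplex_sum)
qed

lemma KL_div_nonneg:
  assumes "p \<in> prob_simplex" "q \<in> prob_simplex"
  shows "0 \<le> KL_div p q"
proof (cases "\<forall>\<omega>. q $ \<omega> = 0 \<longrightarrow> p $ \<omega> = 0")
  case True
  have "0 \<le> (\<Sum>\<omega>\<in>UNIV. (sqrt (p $ \<omega>) - sqrt (q $ \<omega>))\<^sup>2)"
    by (simp add: sum_nonneg)
  then show ?thesis using KL_real_ge[OF assms] True KL_div_eq_KL_real[of q p] by force
next
  case False
  then show ?thesis using KL_div_eq_infinity[of p _ q] by auto
qed

lemma KL_div_eq_0_iff:
  assumes "p \<in> prob_simplex" "q \<in> prob_simplex"
  shows "KL_div p q = 0 \<longleftrightarrow> p = q"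
proof
  assume 0: "KL_div p q = 0"
  then have ac: "q $ \<omega> = 0 \<Longrightarrow> p $ \<omega> = 0" for \<omega>
    using KL_div_eq_infinity[of p \<omega> q] by auto
  have "(\<Sum>\<omega>\<in>UNIV. (sqrt (p $ \<omega>) - sqrt (q $ \<omega>))\<^sup>2) \<le> 0"
    using KL_real_ge[OF assms ac] 0 KL_div_eq_KL_real[of q p] ac by simp
  then have "(\<Sum>\<omega>\<in>UNIV. (sqrt (p $ \<omega>) - sqrt (q $ \<omega>))\<^sup>2) = 0"
    by (simp add: antisym sum_nonneg)
  then show "p = q" by (simp add: sum_nonneg_eq_0_iff vec_eq_iff)
next
  assume "p = q"
  then show "KL_div p q = 0"
    by (subst KL_div_eq_KL_real) (auto simp: KL_real_def intro!: sum.neutral)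
qed

text \<open>If \<open>s\<close> vanishes nowhere on the support of \<open>p\<close>, the sum
  converges term by term. Otherwise one term tends to \<infinity> while the others stay bounded
  below, in accordance with \<open>KL_div p s\<close> being \<infinity>.\<close>

lemma KL_div_tendsto:
  fixes p :: "real ^ 'w::finite"
  assumes p: "p \<in> prob_simplex" and r: "\<And>m. r m \<in> prob_simplex"
    and ac: "\<And>m \<omega>. r m $ \<omega> = 0 \<Longrightarrow> p $ \<omega> = 0" and lim: "r \<longlonglongrightarrow> s"
  shows "(\<lambda>m. KL_div p (r m)) \<longlonglongrightarrow> KL_div p s"
proof -
  have eq: "KL_div p (r m) = ereal (KL_real p (r m))" for m
    using ac by (rule KL_div_eq_KL_real)
  have lim': "(\<lambda>m. r m $ \<omega>) \<longlonglongrightarrow> s $ \<omega>" for \<omega>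
    using lim by (rule tendsto_vec_nth)
  show ?thesis
  proof (cases "\<forall>\<omega>. s $ \<omega> = 0 \<longrightarrow> p $ \<omega> = 0")
    case True
    have "(\<lambda>m. p $ \<omega> * ln (p $ \<omega> / r m $ \<omega>)) \<longlonglongrightarrow> p $ \<omega> * ln (p $ \<omega> / s $ \<omega>)" for \<omega>
      using True by (cases "p $ \<omega> = 0") (auto intro!: tendsto_intros lim')
    then have "(\<lambda>m. KL_real p (r m)) \<longlonglongrightarrow> KL_real p s"
      unfolding KL_real_def by (intro tendsto_sum)
    then show ?thesis
      using True by (simp add: eq KL_div_eq_KL_real)
  next
    case False
    then obtain v where v: "s $ v = 0" "p $ v \<noteq> 0" by blast
    then have pv: "0 < p $ v" using prob_simplex_nonneg[OF p, of v] by simp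
    have rv: "0 < r m $ v" for m
      using ac[of m v] v prob_simplex_nonneg[OF r, of m v] by (auto simp: less_le)
    \<comment> \<open>Each term other than that of \<open>v\<close> is at least
      \<open>p $ \<omega> - r m $ \<omega>\<close>, so together they are at least -1, uniformly in
      \<open>m\<close>.\<close>
    have lower: "p $ v * ln (p $ v) - 1 + p $ v * - ln (r m $ v) \<le> KL_real p (r m)" for m
    proof -
      have "- 1 \<le> - (\<Sum>\<omega>\<in>UNIV-{v}. r m $ \<omega>)"
        using prob_simplex_sum[OF r, of m] rv[of m]
        by (simp add: sum.remove[of UNIV v "\<lambda>\<omega>. r m $ \<omega>"])
      also have "\<dots> \<le> (\<Sum>\<omega>\<in>UNIV-{v}. p $ \<omega> - r m $ \<omega>)"
        using prob_simplex_nonneg[OF p] by (simp add: sum_subtractf sum_nonneg)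
      also have "\<dots> \<le> (\<Sum>\<omega>\<in>UNIV-{v}. p $ \<omega> * ln (p $ \<omega> / r m $ \<omega>))"
      proof (rule sum_mono)
        fix \<omega>
        show "p $ \<omega> - r m $ \<omega> \<le> p $ \<omega> * ln (p $ \<omega> / r m $ \<omega>)"
          using mult_ln_ratio_ge[OF prob_simplex_nonneg[OF p] prob_simplex_nonneg[OF r] ac]
            zero_le_power2[of "sqrt (p $ \<omega>) - sqrt (r m $ \<omega>)"]
          by (meson add_increasing2 order_trans order_refl)
      qed
      finally show ?thesis
        unfolding KL_real_def using pv rv[of m]
        by (simp add: sum.remove[of UNIV v] ln_div algebra_simps)
    qed
    have "filterlim (\<lambda>m. r m $ v) (at_right 0) sequentially"
      using lim'[of v] v(1) by (intro tendsto_imp_filterlim_at_right) (simp_all add: rv)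
    then have "filterlim (\<lambda>m. - ln (r m $ v)) at_top sequentially"
      using filterlim_compose[OF ln_at_0] by (simp add: filterlim_uminus_at_bot)
    then have "filterlim (\<lambda>m. p $ v * ln (p $ v) - 1 + p $ v * - ln (r m $ v)) at_top sequentially"
      using pv by (intro filterlim_tendsto_add_at_top filterlim_tendsto_pos_mult_at_top) auto
    then have "filterlim (\<lambda>m. KL_real p (r m)) at_top sequentially"
      by (rule filterlim_at_top_mono) (rule always_eventually[OF allI[OF lower]])
    then show ?thesis
      using KL_div_eq_infinity[OF v(2,1)] by (simp add: eq tendsto_PInfty_eq_at_top)
  qed
qed

section \<open>Finite tilts and the closure of the exponential family\<close>

abbreviation real_tilt :: "('w::finite \<Rightarrow> real ^ 'n::finite) \<Rightarrow> real ^ 'n \<Rightarrow> real ^ 'w \<Rightarrow> real ^ 'w"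
  where "real_tilt f l q \<equiv> tilt f (\<chi> i. ereal (l $ i)) q"

lemma exp_ext_lin_comb_real: "exp_ext (lin_comb f (\<chi> i. ereal (l $ i)) \<omega>) = exp (l \<bullet> f \<omega>)"
  by (simp add: exp_ext_def lin_comb_def inner_vec_def)

lemma norm_const_real:
  "norm_const f (\<chi> i. ereal (l $ i)) q = (\<Sum>\<omega>\<in>UNIV. exp (l \<bullet> f \<omega>) * q $ \<omega>)"
  by (simp add: norm_const_def exp_ext_lin_comb_real)

lemma real_tilt_nth:
  "real_tilt f l q $ \<omega> = exp (l \<bullet> f \<omega>) * q $ \<omega> / norm_const f (\<chi> i. ereal (l $ i)) q"
  by (simp add: tilt_def exp_ext_lin_comb_real)

lemma norm_const_real_pos:
  assumes "q \<in> prob_simplex"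
  shows "0 < norm_const f (\<chi> i. ereal (l $ i)) q"
proof -
  obtain v where "0 < q $ v" using prob_simplex_ex_pos[OF assms] .
  then show ?thesis
    unfolding norm_const_real
    by (intro sum_pos2[of _ v]) (use prob_simplex_nonneg[OF assms] in auto)
qed

lemma real_tilt_in_prob_simplex:
  assumes "q \<in> prob_simplex"
  shows "real_tilt f l q \<in> prob_simplex"
proof -
  have "(\<Sum>\<omega>\<in>UNIV. real_tilt f l q $ \<omega>) = 1"
    using norm_const_real_pos[OF assms, of f l]
    by (simp add: real_tilt_nth sum_divide_distrib[symmetric] norm_const_real)
  then show ?thesis
    using norm_const_real_pos[OF assms, of f l] prob_simplex_nonneg[OF assms]
    by (simp add: prob_simplex_def real_tilt_nth less_imp_le)
qed

lemma real_tilt_eq_0_iff: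
  "q \<in> prob_simplex \<Longrightarrow> real_tilt f l q $ \<omega> = 0 \<longleftrightarrow> q $ \<omega> = 0"
  using norm_const_real_pos[of q f l] by (simp add: real_tilt_nth)

text \<open>The inner normalising constant cancels between numerator and denominator. Parameters
  therefore add, and a tilt of a member of the family is again a single tilt of
  \<open>q\<close>.\<close>

lemma real_tilt_real_tilt:
  assumes "q \<in> prob_simplex"
  shows "real_tilt f l (real_tilt f l' q) = real_tilt f (l + l') q"
proof -
  define Z where "Z = norm_const f (\<chi> i. ereal (l' $ i)) q"
  have Z: "Z > 0" unfolding Z_def by (rule norm_const_real_pos[OF assms])
  have nth: "exp (l \<bullet> f \<omega>) * real_tilt f l' q $ \<omega> = exp ((l + l') \<bullet> f \<omega>) * q $ \<omega> / Z" for \<omega>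
    by (simp add: real_tilt_nth Z_def inner_add_left exp_add)
  have "norm_const f (\<chi> i. ereal (l $ i)) (real_tilt f l' q)
      = norm_const f (\<chi> i. ereal ((l + l') $ i)) q / Z"
    unfolding norm_const_real nth by (simp add: sum_divide_distrib)
  then show ?thesis
    using Z unfolding vec_eq_iff real_tilt_nth[of f l] real_tilt_nth[of f "l + l'"] nth by simp
qed

lemma exp_family_closure_eq:
  assumes "q0 \<in> prob_simplex"
  shows "exp_family_closure f q0 = closure (exp_family f q0)"
proof -
  have sub: "exp_family f q0 \<subseteq> prob_simplex"
    using real_tilt_in_prob_simplex[OF assms] by (auto simp: exp_family_def)
  then have "closure (exp_family f q0) \<subseteq> prob_simplex"
    by (intro closure_minimal compact_imp_closed compact_prob_simplex)
  then show ?thesis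
    using sub by (simp add: exp_family_closure_def closure_of_subtopology Int_absorb1 Int_absorb2)
qed

text \<open>The parameters \<open>l m\<close> need not converge; a limit outside the family is
  reached only along unbounded ones.\<close>

lemma exp_family_closure_seq:
  assumes "q0 \<in> prob_simplex" "r \<in> exp_family_closure f q0"
  obtains l where "(\<lambda>m. real_tilt f (l m) q0) \<longlonglongrightarrow> r"
proof -
  obtain x where x: "\<And>m. x m \<in> exp_family f q0" "x \<longlonglongrightarrow> r"
    using assms by (auto simp: exp_family_closure_eq closure_sequential)
  then have "\<forall>m. \<exists>l. x m = real_tilt f l q0" by (auto simp: exp_family_def)
  then obtain l where "\<And>m. x m = real_tilt f (l m) q0" by metis
  then show ?thesis using that x(2) by (metis (no_types, lifting) ext)
qed

lemma exp_family_closure_limit: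
  assumes "q0 \<in> prob_simplex" "(\<lambda>m. real_tilt f (l m) q0) \<longlonglongrightarrow> r"
  shows "r \<in> exp_family_closure f q0"
  using assms by (auto simp: exp_family_closure_eq closure_sequential exp_family_def
      intro!: exI[of _ "\<lambda>m. real_tilt f (l m) q0"])

lemma exp_family_closure_subset: "exp_family_closure f q0 \<subseteq> prob_simplex"
  unfolding exp_family_closure_def using closure_of_subset_topspace[of "top_of_set prob_simplex"] by simp

lemma exp_family_closure_zero:
  assumes "q0 \<in> prob_simplex" "r \<in> exp_family_closure f q0" "q0 $ \<omega> = 0"
  shows "r $ \<omega> = 0"
proof -
  obtain l where "(\<lambda>m. real_tilt f (l m) q0) \<longlonglongrightarrow> r"
    using exp_family_closure_seq[OF assms(1,2)] .
  then have "(\<lambda>m. real_tilt f (l m) q0 $ \<omega>) \<longlonglongrightarrow> r $ \<omega>"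
    by (rule tendsto_vec_nth)
  then show ?thesis
    using assms by (simp add: real_tilt_nth LIMSEQ_const_iff)
qed

section \<open>The Pythagorean identity\<close>

lemma KL_real_real_tilt:
  assumes q0: "q0 \<in> prob_simplex" and p: "p \<in> prob_simplex"
    and ac: "\<And>\<omega>. q0 $ \<omega> = 0 \<Longrightarrow> p $ \<omega> = 0"
  shows "KL_real p (real_tilt f l q0)
    = KL_real p q0 - l \<bullet> mean p f + ln (norm_const f (\<chi> i. ereal (l $ i)) q0)"
proof -
  define Z where "Z = norm_const f (\<chi> i. ereal (l $ i)) q0"
  have Z: "Z > 0" unfolding Z_def by (rule norm_const_real_pos[OF q0])
  have "p $ \<omega> * ln (p $ \<omega> / real_tilt f l q0 $ \<omega>)
      = p $ \<omega> * ln (p $ \<omega> / q0 $ \<omega>) - p $ \<omega> * (l \<bullet> f \<omega>) + p $ \<omega> * ln Z" for \<omega>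
  proof (cases "p $ \<omega> = 0")
    case False
    then have "p $ \<omega> > 0" "q0 $ \<omega> > 0"
      using ac[of \<omega>] prob_simplex_nonneg[OF p, of \<omega>] prob_simplex_nonneg[OF q0, of \<omega>] by (auto simp: less_le)
    then show ?thesis
      using Z by (simp add: real_tilt_nth Z_def[symmetric] ln_div ln_mult algebra_simps)
  qed simp
  then show ?thesis
    by (simp add: KL_real_def sum.distrib sum_subtractf sum_distrib_right[symmetric]
        prob_simplex_sum[OF p] Z_def mean_def inner_sum_right)
qed

text \<open>For \<open>r\<close> in the family itself, \<open>KL_div p r\<close> and
  \<open>KL_div s r\<close> differ by a constant \<open>c\<close>, since the means of
  \<open>f\<close> agree. Continuity in the second argument carries this to the closure, and
  \<open>r = s\<close> identifies \<open>c\<close> as \<open>KL_div p s\<close>.\<close>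

lemma KL_div_pythagoras:
  assumes q0: "q0 \<in> prob_simplex"
    and s: "s \<in> exp_family_closure f q0" and p: "p \<in> prob_simplex"
    and mean: "mean p f = mean s f"
    and ac: "\<And>\<omega>. q0 $ \<omega> = 0 \<Longrightarrow> p $ \<omega> = 0"
    and r: "r \<in> exp_family_closure f q0"
  shows "KL_div p s \<noteq> \<infinity>" and "KL_div p r = KL_div p s + KL_div s r"
proof -
  have ss: "s \<in> prob_simplex" using s exp_family_closure_subset by blast
  have sac: "q0 $ \<omega> = 0 \<Longrightarrow> s $ \<omega> = 0" for \<omega>
    using exp_family_closure_zero[OF q0 s] .
  define c where "c = KL_real p q0 - KL_real s q0"
  have fin: "KL_div p (real_tilt f l q0) = ereal (KL_real p (real_tilt f l q0))"
            "KL_div s (real_tilt f l q0) = ereal (KL_real s (real_tilt f l q0))" for l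
    by (rule KL_div_eq_KL_real; simp add: real_tilt_eq_0_iff[OF q0] ac sac)+
  have eq: "KL_div p (real_tilt f l q0) = ereal c + KL_div s (real_tilt f l q0)" for l
    by (simp add: fin KL_real_real_tilt[OF q0 p ac] KL_real_real_tilt[OF q0 ss sac] c_def mean)
  have lim: "KL_div p t = ereal c + KL_div s t" if "t \<in> exp_family_closure f q0" for t
  proof -
    obtain l where l: "(\<lambda>m. real_tilt f (l m) q0) \<longlonglongrightarrow> t"
      using exp_family_closure_seq[OF q0 \<open>t \<in> _\<close>] .
    have "(\<lambda>m. KL_div p (real_tilt f (l m) q0)) \<longlonglongrightarrow> KL_div p t"
      by (rule KL_div_tendsto[OF p real_tilt_in_prob_simplex[OF q0] _ l])
        (simp add: real_tilt_eq_0_iff[OF q0] ac)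
    moreover have "(\<lambda>m. KL_div s (real_tilt f (l m) q0)) \<longlonglongrightarrow> KL_div s t"
      by (rule KL_div_tendsto[OF ss real_tilt_in_prob_simplex[OF q0] _ l])
        (simp add: real_tilt_eq_0_iff[OF q0] sac)
    then have "(\<lambda>m. ereal c + KL_div s (real_tilt f (l m) q0)) \<longlonglongrightarrow> ereal c + KL_div s t"
      by (intro tendsto_add_ereal_general) auto
    ultimately show ?thesis
      unfolding eq by (rule LIMSEQ_unique)
  qed
  have ps: "KL_div p s = ereal c"
    using lim[OF s] KL_div_eq_0_iff[OF ss ss] by simp
  then show "KL_div p s \<noteq> \<infinity>" by simp
  show "KL_div p r = KL_div p s + KL_div s r"
    using lim[OF r] ps by simp
qed

section \<open>Tilts whose parameters may be -\<infinity>\<close>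

lemma exp_ext_nonneg: "0 \<le> exp_ext x"
  by (simp add: exp_ext_def)

lemma exp_ext_times:
  assumes "c \<noteq> \<infinity>" "0 \<le> x"
  shows "exp_ext (c * ereal x) = (if c = - \<infinity> \<and> 0 < x then 0 else exp (real_of_ereal c * x))"
  using assms by (cases c) (auto simp: exp_ext_def)

text \<open>No summand is \<infinity>, so a single summand -\<infinity> decides the sum. In the
  other case an infinite component meets only a zero feature, so the value 0 that
  \<open>real_of_ereal\<close> gives it does no harm.\<close>

lemma exp_ext_lin_comb:
  assumes "\<And>i. 0 \<le> f \<omega> $ i" "\<And>i. \<gamma> $ i \<noteq> \<infinity>"
  shows "exp_ext (lin_comb f \<gamma> \<omega>)
    = (if \<exists>i. \<gamma> $ i = - \<infinity> \<and> 0 < f \<omega> $ i then 0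
       else exp ((\<chi> i. real_of_ereal (\<gamma> $ i)) \<bullet> f \<omega>))"
proof (cases "\<exists>i. \<gamma> $ i = - \<infinity> \<and> 0 < f \<omega> $ i")
  case True
  then obtain i where i: "\<gamma> $ i * ereal (f \<omega> $ i) = - \<infinity>" by auto
  have "\<gamma> $ j * ereal (f \<omega> $ j) \<noteq> \<infinity>" for j
    using assms(1)[of j] assms(2)[of j] by (cases "\<gamma> $ j") auto
  then have "lin_comb f \<gamma> \<omega> \<noteq> \<infinity>"
    by (simp add: lin_comb_def sum_Pinfty)
  moreover have "\<bar>lin_comb f \<gamma> \<omega>\<bar> = \<infinity>"
    unfolding lin_comb_def sum_Inf using i by (auto intro!: exI[of _ i])
  ultimately have "lin_comb f \<gamma> \<omega> = - \<infinity>" by (cases "lin_comb f \<gamma> \<omega>") auto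
  then show ?thesis using True by (simp add: exp_ext_def)
next
  case False
  have "\<gamma> $ i * ereal (f \<omega> $ i) = ereal (real_of_ereal (\<gamma> $ i) * f \<omega> $ i)" for i
    using assms(1)[of i] assms(2)[of i] False by (cases "\<gamma> $ i") (auto simp: not_less le_less)
  then show ?thesis
    using False by (auto simp: lin_comb_def exp_ext_def inner_vec_def)
qed

text \<open>Each component -\<infinity> is replaced by \<open>- real m\<close>. With
  \<open>c\<close> the total of the features so affected, the exponential is a constant times
  \<open>exp (- c) ^ m\<close>, which tends to 0 if \<open>c > 0\<close> and is constant if
  \<open>c = 0\<close>.\<close>

lemma exp_ext_lin_comb_limit:
  assumes "\<And>i. 0 \<le> f \<omega> $ i" "\<And>i. \<gamma> $ i \<noteq> \<infinity>"
  shows "(\<lambda>m. exp ((\<chi> i. if \<gamma> $ i = - \<infinity> then - real m else real_of_ereal (\<gamma> $ i)) \<bullet> f \<omega>))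
    \<longlonglongrightarrow> exp_ext (lin_comb f \<gamma> \<omega>)"
proof -
  define G where "G = (\<chi> i. real_of_ereal (\<gamma> $ i)) \<bullet> f \<omega>"
  define c where "c = (\<Sum>i\<in>UNIV. if \<gamma> $ i = - \<infinity> then f \<omega> $ i else 0)"
  \<comment> \<open>The identity holds at infinite components too, because
    \<open>real_of_ereal (- \<infinity>) = 0\<close>.\<close>
  have "(if \<gamma> $ i = - \<infinity> then - real m else real_of_ereal (\<gamma> $ i)) * f \<omega> $ i
      = real_of_ereal (\<gamma> $ i) * f \<omega> $ i - real m * (if \<gamma> $ i = - \<infinity> then f \<omega> $ i else 0)" for m i
    by simp
  then have "(\<chi> i. if \<gamma> $ i = - \<infinity> then - real m else real_of_ereal (\<gamma> $ i)) \<bullet> f \<omega>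
      = G - real m * c" for m
    unfolding inner_vec_def G_def c_def by (simp add: sum_subtractf sum_distrib_left)
  then have eq: "exp ((\<chi> i. if \<gamma> $ i = - \<infinity> then - real m else real_of_ereal (\<gamma> $ i)) \<bullet> f \<omega>)
      = exp G * exp (- c) ^ m" for m
    using exp_of_nat_mult[of m "- c"] exp_add[of G "real m * - c"] by simp
  have c0: "0 \<le> c"
    unfolding c_def by (rule sum_nonneg) (simp add: assms)
  show ?thesis
  proof (cases "\<exists>i. \<gamma> $ i = - \<infinity> \<and> 0 < f \<omega> $ i")
    case True
    then obtain i where "\<gamma> $ i = - \<infinity>" "0 < f \<omega> $ i" by blast
    then have "0 < c"
      unfolding c_def by (intro sum_pos2[of _ i]) (auto simp: assms)
    then have "(\<lambda>m. exp G * exp (- c) ^ m) \<longlonglongrightarrow> exp G * 0"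
      by (intro tendsto_intros) simp
    then show ?thesis
      using True by (simp add: eq exp_ext_lin_comb assms)
  next
    case False
    then have "c = 0"
      unfolding c_def using assms(1) by (intro sum.neutral) (auto simp: not_less antisym)
    then show ?thesis
      unfolding exp_ext_lin_comb[of f \<omega> \<gamma>, OF assms] if_not_P[OF False] by (simp add: eq G_def)
  qed
qed

text \<open>Approximate \<open>q\<close> by finite tilts \<open>r m\<close> of \<open>q0\<close>,
  and \<gamma> by finite parameters \<open>g m\<close>. The limiting normalising constant is
  nonzero, so the tilts of \<open>r m\<close> by \<open>g m\<close> converge; as parameters add,
  they lie in the family.\<close>

lemma tilt_in_exp_family_closure:
  fixes f :: "'w::finite \<Rightarrow> real ^ 'n::finite"
  assumes q0: "q0 \<in> prob_simplex" and f: "\<And>\<omega> i. 0 \<le> f \<omega> $ i"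
    and \<gamma>: "\<And>i. \<gamma> $ i \<noteq> \<infinity>" and q: "q \<in> exp_family_closure f q0"
    and Z: "norm_const f \<gamma> q \<noteq> 0"
  shows "tilt f \<gamma> q \<in> exp_family_closure f q0"
proof -
  obtain l where l: "(\<lambda>m. real_tilt f (l m) q0) \<longlonglongrightarrow> q"
    using exp_family_closure_seq[OF q0 q] .
  define g :: "nat \<Rightarrow> real ^ 'n"
    where "g m = (\<chi> i. if \<gamma> $ i = - \<infinity> then - real m else real_of_ereal (\<gamma> $ i))" for m
  define r where "r m = real_tilt f (l m) q0" for m
  have E: "(\<lambda>m. exp (g m \<bullet> f \<omega>) * r m $ \<omega>) \<longlonglongrightarrow> exp_ext (lin_comb f \<gamma> \<omega>) * q $ \<omega>" for \<omega>
    unfolding g_def r_def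
    by (intro tendsto_mult exp_ext_lin_comb_limit f \<gamma> tendsto_vec_nth l)
  then have "(\<lambda>m. norm_const f (\<chi> i. ereal (g m $ i)) (r m)) \<longlonglongrightarrow> norm_const f \<gamma> q"
    unfolding norm_const_real unfolding norm_const_def by (intro tendsto_sum)
  then have "(\<lambda>m. real_tilt f (g m) (r m) $ \<omega>) \<longlonglongrightarrow> tilt f \<gamma> q $ \<omega>" for \<omega>
    using tendsto_divide[OF E _ Z] by (simp add: real_tilt_nth) (simp add: tilt_def)
  then have "(\<lambda>m. real_tilt f (g m) (r m)) \<longlonglongrightarrow> tilt f \<gamma> q"
    by (rule vec_tendstoI)
  then have "(\<lambda>m. real_tilt f (g m + l m) q0) \<longlonglongrightarrow> tilt f \<gamma> q"
    unfolding r_def real_tilt_real_tilt[OF q0] .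
  then show ?thesis by (rule exp_family_closure_limit[OF q0])
qed

text \<open>Convexity of \<open>exp\<close> with weights \<open>f\<^sub>i / f\<^sub>#\<close>; where \<open>f\<^sub># = 0\<close>, all \<open>f\<^sub>i\<close> vanish and
  both sides are 1, since \<open>x / 0 = 0\<close>.\<close>

lemma exp_ext_lin_comb_le:
  fixes f :: "'w \<Rightarrow> real ^ 'n::finite"
  assumes f: "\<And>i. 0 \<le> f \<omega> $ i" and \<gamma>: "\<And>i. \<gamma> $ i \<noteq> \<infinity>"
  shows "exp_ext (lin_comb f \<gamma> \<omega>)
    \<le> 1 + (\<Sum>i\<in>UNIV. f \<omega> $ i / feature_total f \<omega>
                     * (exp_ext (\<gamma> $ i * ereal (feature_total f \<omega>)) - 1))"
proof -
  define F where "F = feature_total f \<omega>"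
  define g where "g i = real_of_ereal (\<gamma> $ i)" for i
  have F0: "0 \<le> F" unfolding F_def feature_total_def by (simp add: sum_nonneg f)
  show ?thesis
  proof (cases "F = 0")
    case True
    then have "f \<omega> $ i = 0" for i
      unfolding F_def feature_total_def using sum_nonneg_eq_0_iff[of UNIV "\<lambda>i. f \<omega> $ i"] f by simp
    then show ?thesis by (simp add: lin_comb_def exp_ext_def flip: zero_ereal_def)
  next
    case False
    then have F: "0 < F" using F0 by simp
    have s1: "(\<Sum>i\<in>UNIV. f \<omega> $ i / F) = 1"
      using False by (simp add: sum_divide_distrib[symmetric] F_def feature_total_def)
    have "exp_ext (lin_comb f \<gamma> \<omega>) \<le> (\<Sum>i\<in>UNIV. f \<omega> $ i / F * exp_ext (\<gamma> $ i * ereal F))"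
    proof (cases "\<exists>i. \<gamma> $ i = - \<infinity> \<and> 0 < f \<omega> $ i")
      case True
      then show ?thesis
        using F by (simp add: exp_ext_lin_comb f \<gamma> sum_nonneg exp_ext_nonneg)
    next
      case no_kill: False
      have "exp (\<Sum>i\<in>UNIV. (f \<omega> $ i / F) *\<^sub>R (g i * F))
          \<le> (\<Sum>i\<in>UNIV. f \<omega> $ i / F * exp (g i * F))"
        using F f s1 by (intro convex_on_sum[OF _ _ exp_convex]) auto
      also have "(\<Sum>i\<in>UNIV. (f \<omega> $ i / F) *\<^sub>R (g i * F)) = (\<chi> i. g i) \<bullet> f \<omega>"
        using F by (simp add: inner_vec_def mult.commute)
      also have "(\<Sum>i\<in>UNIV. f \<omega> $ i / F * exp (g i * F))
          = (\<Sum>i\<in>UNIV. f \<omega> $ i / F * exp_ext (\<gamma> $ i * ereal F))"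
      proof (rule sum.cong[OF refl])
        fix i
        have "\<gamma> $ i = - \<infinity> \<Longrightarrow> f \<omega> $ i = 0" using no_kill f[of i] by (auto simp: less_le)
        then show "f \<omega> $ i / F * exp (g i * F) = f \<omega> $ i / F * exp_ext (\<gamma> $ i * ereal F)"
          using F by (auto simp: exp_ext_times \<gamma> g_def)
      qed
      finally show ?thesis
        unfolding exp_ext_lin_comb[of f \<omega> \<gamma>, OF f \<gamma>] if_not_P[OF no_kill] g_def .
    qed
    then show ?thesis
      using s1 by (simp add: F_def right_diff_distrib sum_subtractf)
  qed
qed

section \<open>Decrease of the divergence in one step\<close>

text \<open>The first conclusion keeps the divergence finite after the update. For the second, the
  decrease is \<gamma> paired with \<open>mean p f\<close>, minus the logarithm of the normalising
  constant \<open>N\<close>. The scaling equation turns the pairing into sums of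
  \<open>u * ln u\<close> under \<open>q\<close>, while \<open>ln N \<le> N - 1\<close> and the
  convexity bound control the logarithm.\<close>

lemma IIS_step:
  fixes f :: "'w::finite \<Rightarrow> real ^ 'n::finite"
  assumes f: "\<And>\<omega> i. 0 \<le> f \<omega> $ i"
    and p: "p \<in> prob_simplex" and q: "q \<in> prob_simplex"
    and ac: "\<And>\<omega>. q $ \<omega> = 0 \<Longrightarrow> p $ \<omega> = 0"
    and \<gamma>: "\<And>i. \<gamma> $ i \<noteq> \<infinity>"
    and eq: "\<And>i. (\<Sum>\<omega>\<in>UNIV. q $ \<omega> * f \<omega> $ i * exp_ext (\<gamma> $ i * ereal (feature_total f \<omega>)))
          = (\<Sum>\<omega>\<in>UNIV. p $ \<omega> * f \<omega> $ i)"
    and Z: "norm_const f \<gamma> q \<noteq> 0"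
  defines "u \<equiv> \<lambda>i \<omega>. exp_ext (\<gamma> $ i * ereal (feature_total f \<omega>))"
  shows "tilt f \<gamma> q $ \<omega> = 0 \<Longrightarrow> p $ \<omega> = 0"
    and "(\<Sum>i\<in>UNIV. \<Sum>\<omega>\<in>UNIV. q $ \<omega> * (f \<omega> $ i / feature_total f \<omega>)
            * (u i \<omega> * ln (u i \<omega>) - u i \<omega> + 1))
        \<le> KL_real p q - KL_real p (tilt f \<gamma> q)"
proof -
  define F where "F = feature_total f"
  define g where "g i = real_of_ereal (\<gamma> $ i)" for i
  define E where "E \<omega> = exp_ext (lin_comb f \<gamma> \<omega>)" for \<omega>
  define N where "N = norm_const f \<gamma> q"
  have F0: "f \<omega> $ i \<le> F \<omega>" for \<omega> i
    unfolding F_def feature_total_def by (rule member_le_sum) (auto simp: f)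
  have "0 \<le> N" unfolding N_def norm_const_def
    by (intro sum_nonneg mult_nonneg_nonneg exp_ext_nonneg prob_simplex_nonneg q)
  then have N: "0 < N" using Z by (simp add: N_def)
  have tilt: "tilt f \<gamma> q $ \<omega> = E \<omega> * q $ \<omega> / N" for \<omega>
    by (simp add: tilt_def E_def N_def)
  \<comment> \<open>With \<open>\<gamma> $ i = - \<infinity>\<close> the left side of the scaling
    equation is 0, so the \<open>p\<close>-mean of feature \<open>i\<close> is 0 as well: an
    infinite component removes only points without \<open>p\<close>-mass.\<close>
  have kill: "p $ \<omega> = 0" if "\<gamma> $ i = - \<infinity>" "0 < f \<omega> $ i" for i \<omega>
  proof -
    have "q $ \<omega> * f \<omega> $ i * exp_ext (\<gamma> $ i * ereal (F \<omega>)) = 0" for \<omega>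
      using f[of \<omega> i] F0[of \<omega> i] that(1) by (cases "f \<omega> $ i = 0") (auto simp: exp_ext_def)
    then have "(\<Sum>\<omega>\<in>UNIV. p $ \<omega> * f \<omega> $ i) = 0"
      unfolding eq[symmetric] F_def by (rule sum.neutral[OF ballI])
    then have "p $ \<omega> * f \<omega> $ i = 0"
      using sum_nonneg_eq_0_iff[of UNIV "\<lambda>\<omega>. p $ \<omega> * f \<omega> $ i"] f prob_simplex_nonneg[OF p] by simp
    then show ?thesis using that by simp
  qed
  have Ep: "E \<omega> = exp (\<Sum>i\<in>UNIV. g i * f \<omega> $ i)" if "p $ \<omega> \<noteq> 0" for \<omega>
    using kill that unfolding E_def by (auto simp: exp_ext_lin_comb f \<gamma> g_def inner_vec_def)
  show ac': "p $ \<omega> = 0" if "tilt f \<gamma> q $ \<omega> = 0" for \<omega>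
    using that Ep[of \<omega>] N ac[of \<omega>] by (cases "p $ \<omega> = 0") (simp_all add: tilt)
  have "p $ \<omega> * ln (p $ \<omega> / q $ \<omega>) - p $ \<omega> * ln (p $ \<omega> / tilt f \<gamma> q $ \<omega>)
      = (\<Sum>i\<in>UNIV. g i * (p $ \<omega> * f \<omega> $ i)) - p $ \<omega> * ln N" for \<omega>
  proof (cases "p $ \<omega> = 0")
    case False
    then have "p $ \<omega> > 0" "q $ \<omega> > 0"
      using ac[of \<omega>] prob_simplex_nonneg[OF p, of \<omega>] prob_simplex_nonneg[OF q, of \<omega>] by (auto simp: less_le)
    then have "p $ \<omega> * ln (p $ \<omega> / q $ \<omega>) - p $ \<omega> * ln (p $ \<omega> / tilt f \<gamma> q $ \<omega>)
      = p $ \<omega> * (\<Sum>i\<in>UNIV. g i * f \<omega> $ i) - p $ \<omega> * ln N"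
      using N False by (simp add: tilt Ep ln_div ln_mult algebra_simps)
    then show ?thesis by (simp add: sum_distrib_left mult.left_commute)
  qed simp
  then have "KL_real p q - KL_real p (tilt f \<gamma> q)
      = (\<Sum>\<omega>\<in>UNIV. (\<Sum>i\<in>UNIV. g i * (p $ \<omega> * f \<omega> $ i)) - p $ \<omega> * ln N)"
    unfolding KL_real_def by (simp flip: sum_subtractf)
  also have "\<dots> = (\<Sum>\<omega>\<in>UNIV. \<Sum>i\<in>UNIV. g i * (p $ \<omega> * f \<omega> $ i)) - ln N"
    using prob_simplex_sum[OF p] by (simp add: sum_subtractf flip: sum_distrib_right)
  also have "(\<Sum>\<omega>\<in>UNIV. \<Sum>i\<in>UNIV. g i * (p $ \<omega> * f \<omega> $ i))
      = (\<Sum>i\<in>UNIV. g i * (\<Sum>\<omega>\<in>UNIV. p $ \<omega> * f \<omega> $ i))"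
    by (subst sum.swap) (simp add: sum_distrib_left)
  also have "\<dots> = (\<Sum>i\<in>UNIV. \<Sum>\<omega>\<in>UNIV. q $ \<omega> * (f \<omega> $ i / F \<omega>) * (u i \<omega> * ln (u i \<omega>)))"
  proof (rule sum.cong[OF refl])
    fix i
    \<comment> \<open>Where feature \<open>i\<close> is positive, finite \<open>\<gamma> $ i\<close>
      gives \<open>ln (u i \<omega>) = g i * F \<omega>\<close>; for -\<infinity> both sides are 0,
      as \<open>g i = 0\<close> and \<open>u i \<omega> = 0\<close>.\<close>
    have "g i * (q $ \<omega> * f \<omega> $ i * u i \<omega>) = q $ \<omega> * (f \<omega> $ i / F \<omega>) * (u i \<omega> * ln (u i \<omega>))" for \<omega>
    proof (cases "f \<omega> $ i = 0")
      case False
      then have "0 < F \<omega>" using f[of \<omega> i] F0[of \<omega> i] by simp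
      then show ?thesis by (simp add: u_def exp_ext_times \<gamma> F_def g_def)
    qed simp
    then show "g i * (\<Sum>\<omega>\<in>UNIV. p $ \<omega> * f \<omega> $ i)
        = (\<Sum>\<omega>\<in>UNIV. q $ \<omega> * (f \<omega> $ i / F \<omega>) * (u i \<omega> * ln (u i \<omega>)))"
      by (simp add: eq[symmetric] sum_distrib_left u_def)
  qed
  finally have *: "KL_real p q - KL_real p (tilt f \<gamma> q)
      = (\<Sum>i\<in>UNIV. \<Sum>\<omega>\<in>UNIV. q $ \<omega> * (f \<omega> $ i / F \<omega>) * (u i \<omega> * ln (u i \<omega>))) - ln N" .
  have "N \<le> (\<Sum>\<omega>\<in>UNIV. (1 + (\<Sum>i\<in>UNIV. f \<omega> $ i / F \<omega> * (u i \<omega> - 1))) * q $ \<omega>)"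
    unfolding N_def norm_const_def u_def F_def
    by (intro sum_mono mult_right_mono exp_ext_lin_comb_le f \<gamma> prob_simplex_nonneg q)
  also have "\<dots> = 1 + (\<Sum>\<omega>\<in>UNIV. \<Sum>i\<in>UNIV. q $ \<omega> * (f \<omega> $ i / F \<omega>) * (u i \<omega> - 1))"
    by (simp only: distrib_right sum.distrib sum_distrib_right mult_1 prob_simplex_sum[OF q])
      (simp add: mult_ac)
  also have "\<dots> = 1 + (\<Sum>i\<in>UNIV. \<Sum>\<omega>\<in>UNIV. q $ \<omega> * (f \<omega> $ i / F \<omega>) * (u i \<omega> - 1))"
    by (subst sum.swap) simp
  finally have "ln N \<le> (\<Sum>i\<in>UNIV. \<Sum>\<omega>\<in>UNIV. q $ \<omega> * (f \<omega> $ i / F \<omega>) * (u i \<omega> - 1))"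
    using ln_le_minus_one[OF N] by simp
  moreover have "x * (y - v + 1) = x * y - x * (v - 1)" for x y v :: real
    by (simp add: algebra_simps)
  ultimately show "(\<Sum>i\<in>UNIV. \<Sum>\<omega>\<in>UNIV. q $ \<omega> * (f \<omega> $ i / feature_total f \<omega>)
            * (u i \<omega> * ln (u i \<omega>) - u i \<omega> + 1))
        \<le> KL_real p q - KL_real p (tilt f \<gamma> q)"
    unfolding * F_def[symmetric]
    by (simp add: sum_subtractf)
qed

text \<open>Turns a small decrement \<open>c\<close> into a small summand of the scaling gap,
  uniformly in \<open>u\<close>. With \<open>s = \<bar>sqrt u - 1\<bar>\<close> and
  \<open>w = a * (b / F)\<close>, the logarithm inequality gives
  \<open>w * s\<^sup>2 \<le> c\<close>. Then \<open>w \<le> 1\<close> gives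
  \<open>w * s \<le> sqrt c\<close>, and \<open>\<bar>u - 1\<bar> \<le> s\<^sup>2 + 2 * s\<close>
  combines the two.\<close>

lemma scaling_gap_bound:
  fixes a b F u :: real
  assumes "0 \<le> a" "a \<le> 1" "0 \<le> b" "b \<le> F" "0 \<le> u"
  defines "c \<equiv> a * (b / F) * (u * ln u - u + 1)"
  shows "0 \<le> c" and "\<bar>a * b * (u - 1)\<bar> \<le> F * (c + 2 * sqrt c)"
proof -
  define w where "w = a * (b / F)"
  define s where "s = \<bar>sqrt u - 1\<bar>"
  have w: "0 \<le> w" "w \<le> 1"
    using assms(1-4) mult_le_one[of a "b / F"] by (cases "F = 0"; simp add: w_def)+
  have "u - 1 + (sqrt u - 1)\<^sup>2 \<le> u * ln u"
    using mult_ln_ratio_ge[of u 1] assms by simp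
  then have "s\<^sup>2 \<le> u * ln u - u + 1" by (simp add: s_def)
  then have ws: "w * s\<^sup>2 \<le> c" unfolding c_def w_def[symmetric] using w by (intro mult_left_mono)
  then show c: "0 \<le> c" using w by (meson mult_nonneg_nonneg order_trans zero_le_power2)
  have "w * w * s\<^sup>2 \<le> w * s\<^sup>2"
    using w by (intro mult_right_mono mult_left_le_one_le) auto
  then have "(w * s)\<^sup>2 \<le> w * s\<^sup>2" by (simp add: power2_eq_square mult_ac)
  then have "w * s \<le> sqrt c" using ws by (intro real_le_rsqrt) simp
  have "\<bar>u - 1\<bar> = \<bar>(sqrt u - 1)\<^sup>2 + 2 * (sqrt u - 1)\<bar>"
    using assms(5) by (simp add: power2_diff)
  also have "\<dots> \<le> s\<^sup>2 + 2 * s"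
    using abs_triangle_ineq[of "(sqrt u - 1)\<^sup>2" "2 * (sqrt u - 1)"]
    by (simp only: s_def abs_mult abs_numeral power2_abs abs_power2)
  finally have "\<bar>u - 1\<bar> \<le> s\<^sup>2 + 2 * s" .
  then have "w * \<bar>u - 1\<bar> \<le> w * (s\<^sup>2 + 2 * s)" using w by (intro mult_left_mono)
  also have "\<dots> \<le> c + 2 * sqrt c" using ws \<open>w * s \<le> sqrt c\<close> by (simp add: algebra_simps)
  finally have "F * (w * \<bar>u - 1\<bar>) \<le> F * (c + 2 * sqrt c)" using assms by (intro mult_left_mono) auto
  moreover have "a * b = F * w" using assms(3,4) by (cases "F = 0") (auto simp: w_def)
  ultimately show "\<bar>a * b * (u - 1)\<bar> \<le> F * (c + 2 * sqrt c)"
    using w assms(3,4) by (simp add: abs_mult)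
qed

section \<open>From limit points to convergence of the run\<close>

text \<open>Otherwise a subsequence stays away from \<open>z\<close>, and by compactness a further
  subsequence has a limit other than \<open>z\<close>.\<close>

lemma LIMSEQ_compact_unique:
  fixes x :: "nat \<Rightarrow> 'a::metric_space"
  assumes "compact S" "\<And>n. x n \<in> S"
    and uniq: "\<And>\<phi> y. strict_mono \<phi> \<Longrightarrow> (x \<circ> \<phi>) \<longlonglongrightarrow> y \<Longrightarrow> y = z"
  shows "x \<longlonglongrightarrow> z"
proof (rule ccontr)
  assume "\<not> x \<longlonglongrightarrow> z"
  then obtain e where "0 < e" and "\<exists>\<^sub>F n in sequentially. e \<le> dist (x n) z"
    unfolding tendsto_iff by (auto simp: not_eventually not_less)
  then have "infinite {n. e \<le> dist (x n) z}"
    by (simp add: frequently_cofinite flip: cofinite_eq_sequentially)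
  then obtain \<phi> :: "nat \<Rightarrow> nat" where \<phi>: "strict_mono \<phi>" "\<And>n. e \<le> dist (x (\<phi> n)) z"
    using infinite_enumerate by blast
  obtain y \<psi> where \<psi>: "strict_mono \<psi>" "((x \<circ> \<phi>) \<circ> \<psi>) \<longlonglongrightarrow> y"
    using assms(1) unfolding compact_def
    by (metis assms(2) comp_apply)
  then have y: "y = z"
    using \<phi>(1) by (intro uniq[of "\<phi> \<circ> \<psi>"]) (auto simp: strict_mono_o o_assoc)
  have "(\<lambda>n. dist (x (\<phi> (\<psi> n))) z) \<longlonglongrightarrow> dist z z"
    using \<psi>(2) unfolding y o_def by (intro tendsto_intros)
  then have "e \<le> 0"
    using \<phi>(2) by (intro LIMSEQ_le_const[of _ _ e]) auto
  then show False using \<open>0 < e\<close> by simp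
qed

theorem proposition4p1:
  fixes f :: "'w::finite \<Rightarrow> real ^ 'n::finite"
    and pt q0 :: "real ^ 'w"
    and \<gamma> :: "nat \<Rightarrow> ereal ^ 'n"
    and q :: "nat \<Rightarrow> real ^ 'w"
  assumes f_nonneg: "\<And>\<omega> i. 0 \<le> f \<omega> $ i"
    and pt: "pt \<in> prob_simplex"
    and q0: "q0 \<in> prob_simplex"
    and pt_ll_q0: "\<And>\<omega>. q0 $ \<omega> = 0 \<Longrightarrow> pt $ \<omega> = 0"
    and IIS: "IIS_run f pt q0 \<gamma> q"
  shows "\<exists>qs.
      {r. is_arg_min (\<lambda>r. KL_div pt r) (\<lambda>r. r \<in> exp_family_closure f q0) r} = {qs}
    \<and> {p. is_arg_min (\<lambda>p. KL_div p q0) (\<lambda>p. p \<in> linear_family f pt) p} = {qs}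
    \<and> decseq (\<lambda>k. KL_div pt (q k))
    \<and> (\<lambda>k. KL_div pt (q k)) \<longlonglongrightarrow> KL_div pt qs
    \<and> q \<longlonglongrightarrow> qs"
proof -
  define u where "u k i \<omega> = exp_ext (\<gamma> k $ i * ereal (feature_total f \<omega>))" for k i \<omega>
  define c where "c k i \<omega> = q k $ \<omega> * (f \<omega> $ i / feature_total f \<omega>)
    * (u k i \<omega> * ln (u k i \<omega>) - u k i \<omega> + 1)" for k i \<omega>
  from IIS have q_0: "q 0 = q0" and q: "q k \<in> prob_simplex" and \<gamma>: "\<gamma> k $ i \<noteq> \<infinity>"
    and eq: "(\<Sum>\<omega>\<in>UNIV. q k $ \<omega> * f \<omega> $ i * exp_ext (\<gamma> k $ i * ereal (feature_total f \<omega>)))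
          = (\<Sum>\<omega>\<in>UNIV. pt $ \<omega> * f \<omega> $ i)"
    and Z: "norm_const f (\<gamma> k) (q k) \<noteq> 0" and q_Suc: "q (Suc k) = tilt f (\<gamma> k) (q k)" for k i
    unfolding IIS_run_def by auto
  note step = IIS_step[OF f_nonneg pt q _ \<gamma> eq Z, folded q_Suc]
  have ac: "q k $ \<omega> = 0 \<Longrightarrow> pt $ \<omega> = 0" for k \<omega>
  proof (induction k arbitrary: \<omega>)
    case 0
    then show ?case using pt_ll_q0 q_0 by simp
  next
    case (Suc k)
    then show ?case using step(1) by blast
  qed
  have KL_q: "KL_div pt (q k) = ereal (KL_real pt (q k))" for k
    using ac by (rule KL_div_eq_KL_real)
  have f_le: "f \<omega> $ i \<le> feature_total f \<omega>" for \<omega> i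
    unfolding feature_total_def by (rule member_le_sum) (auto simp: f_nonneg)
  have bound: "0 \<le> c k i \<omega>"
    "\<bar>q k $ \<omega> * f \<omega> $ i * (u k i \<omega> - 1)\<bar> \<le> feature_total f \<omega> * (c k i \<omega> + 2 * sqrt (c k i \<omega>))"
    for k i \<omega>
    unfolding c_def u_def
    by (rule scaling_gap_bound[OF prob_simplex_nonneg[OF q] prob_simplex_le_1[OF q] f_nonneg f_le
          exp_ext_nonneg])+
  have descent: "(\<Sum>i\<in>UNIV. \<Sum>\<omega>\<in>UNIV. c k i \<omega>) \<le> KL_real pt (q k) - KL_real pt (q (Suc k))" for k
    unfolding c_def u_def using step(2)[OF ac] .
  have c_le: "c k i \<omega> \<le> KL_real pt (q k) - KL_real pt (q (Suc k))" for k i \<omega>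
  proof -
    have "c k i \<omega> \<le> (\<Sum>\<omega>\<in>UNIV. c k i \<omega>)"
      by (rule member_le_sum) (auto simp: bound)
    also have "\<dots> \<le> (\<Sum>i\<in>UNIV. \<Sum>\<omega>\<in>UNIV. c k i \<omega>)"
      by (rule member_le_sum) (auto simp: bound sum_nonneg)
    finally show ?thesis using descent[of k] by simp
  qed
  have dec: "decseq (\<lambda>k. KL_real pt (q k))"
    using c_le bound(1) by (intro decseq_SucI) (meson diff_ge_0_iff_ge order_trans)
  have "0 \<le> KL_real pt (q k)" for k
    using KL_div_nonneg[OF pt q[of k]] by (simp add: KL_q)
  then obtain d where d: "(\<lambda>k. KL_real pt (q k)) \<longlonglongrightarrow> d"
    using decseq_convergent[OF dec] by metis
  have diff: "(\<lambda>k. KL_real pt (q k) - KL_real pt (q (Suc k))) \<longlonglongrightarrow> 0"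
    using tendsto_diff[OF d LIMSEQ_Suc[OF d]] by simp
  have c_lim: "(\<lambda>k. c k i \<omega>) \<longlonglongrightarrow> 0" for i \<omega>
    by (rule tendsto_sandwich[OF _ _ tendsto_const diff]) (auto simp: bound c_le)
  have gap: "(\<lambda>k. q k $ \<omega> * f \<omega> $ i * (u k i \<omega> - 1)) \<longlonglongrightarrow> 0" for i \<omega>
  proof (rule Lim_null_comparison)
    show "(\<lambda>k. feature_total f \<omega> * (c k i \<omega> + 2 * sqrt (c k i \<omega>))) \<longlonglongrightarrow> 0"
      by (rule tendsto_eq_intros c_lim refl | simp)+
  qed (simp add: bound)
  have mean_diff: "(\<lambda>k. mean pt f $ i - mean (q k) f $ i) \<longlonglongrightarrow> 0" for i
  proof -
    \<comment> \<open>The scaling equation writes the target mean as a mean under \<open>q k\<close>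
      weighted by \<open>u k i \<omega>\<close>, so the two means differ exactly by the scaling
      gap.\<close>
    have "mean pt f $ i - mean (q k) f $ i = (\<Sum>\<omega>\<in>UNIV. q k $ \<omega> * f \<omega> $ i * (u k i \<omega> - 1))" for k
      by (simp add: mean_def eq[symmetric, of i k] u_def right_diff_distrib sum_subtractf)
    moreover have "(\<lambda>k. \<Sum>\<omega>\<in>UNIV. q k $ \<omega> * f \<omega> $ i * (u k i \<omega> - 1)) \<longlonglongrightarrow> (\<Sum>\<omega>\<in>(UNIV :: 'w set). 0)"
      by (intro tendsto_sum gap)
    ultimately show ?thesis by simp
  qed

  \<comment> \<open>Limit points of the run\<close>
  have "real_tilt f 0 q0 = q0"
    unfolding vec_eq_iff real_tilt_nth norm_const_real by (simp add: prob_simplex_sum[OF q0])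
  then have q0_in: "q0 \<in> exp_family_closure f q0"
    using exp_family_closure_limit[OF q0, of f "\<lambda>_. 0" q0] by (simp only: tendsto_const)
  have q_in: "q k \<in> exp_family_closure f q0" for k
    by (induction k) (simp_all add: q_0 q0_in q_Suc tilt_in_exp_family_closure q0 f_nonneg \<gamma> Z)
  have limit: "s \<in> exp_family_closure f q0 \<and> s \<in> linear_family f pt"
    if "strict_mono \<phi>" "(q \<circ> \<phi>) \<longlonglongrightarrow> s" for \<phi> s
  proof
    show s: "s \<in> exp_family_closure f q0"
      using closed_sequentially[of "closure (exp_family f q0)" "q \<circ> \<phi>" s] q_in that(2)
      by (simp add: exp_family_closure_eq[OF q0])
    have "mean pt f $ i = mean s f $ i" for i
    proof -
      have "(\<lambda>k. mean (q (\<phi> k)) f $ i) \<longlonglongrightarrow> mean s f $ i"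
        using that(2) unfolding mean_def o_def by (intro tendsto_intros)
      then have "(\<lambda>k. mean pt f $ i - mean (q (\<phi> k)) f $ i) \<longlonglongrightarrow> mean pt f $ i - mean s f $ i"
        by (rule tendsto_diff[OF tendsto_const])
      moreover have "(\<lambda>k. mean pt f $ i - mean (q (\<phi> k)) f $ i) \<longlonglongrightarrow> 0"
        using LIMSEQ_subseq_LIMSEQ[OF mean_diff that(1)] by (simp add: o_def)
      ultimately show ?thesis using LIMSEQ_unique by fastforce
    qed
    then show "s \<in> linear_family f pt"
      using s exp_family_closure_subset by (auto simp: linear_family_def vec_eq_iff)
  qed
  \<comment> \<open>Compactness provides one limit point, and with it the existence of a point
    common to the linear family and the closure.\<close>
  obtain qs \<phi> where "strict_mono \<phi>" "(q \<circ> \<phi>) \<longlonglongrightarrow> qs"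
    using compact_prob_simplex q unfolding compact_def by metis
  then have qs: "qs \<in> exp_family_closure f q0" "qs \<in> linear_family f pt"
    using limit by blast+
  then have qs': "qs \<in> prob_simplex" "mean qs f = mean pt f"
    by (auto simp: linear_family_def)
  \<comment> \<open>The target \<open>pt\<close> lies in its own linear family, so the Pythagorean
    lemma applies to it; finiteness is what makes the strict comparison in \<open>lt_Q\<close> valid
    in \<open>ereal\<close>.\<close>
  have pt_qs: "KL_div pt qs \<noteq> \<infinity>" "\<bar>KL_div pt qs\<bar> \<noteq> \<infinity>"
    using KL_div_pythagoras(1)[OF q0 qs(1) pt _ pt_ll_q0 q0_in] KL_div_nonneg[OF pt qs'(1)] qs'
    by auto

  \<comment> \<open>The two minimisation problems\<close>
  have min_Q: "KL_div pt r = KL_div pt qs + KL_div qs r" if "r \<in> exp_family_closure f q0" for r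
    by (rule KL_div_pythagoras(2)[OF q0 qs(1) pt _ pt_ll_q0 that]) (simp add: qs')
  have lt_Q: "KL_div pt qs < KL_div pt r" if "r \<in> exp_family_closure f q0" "r \<noteq> qs" for r
  proof -
    have r: "r \<in> prob_simplex" using that exp_family_closure_subset by blast
    have "0 < KL_div qs r"
      using KL_div_nonneg[OF qs'(1) r] KL_div_eq_0_iff[OF qs'(1) r] that(2) by (simp add: less_le)
    then show ?thesis
      using min_Q[OF that(1)] pt_qs by (cases "KL_div pt qs"; cases "KL_div qs r") auto
  qed
  have qs_fin: "KL_div qs q0 \<noteq> \<infinity>"
    using KL_div_eq_KL_real[of q0 qs] exp_family_closure_zero[OF q0 qs(1)] by simp
  \<comment> \<open>The Pythagorean identity covers those \<open>p\<close> that vanish where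
    \<open>q0\<close> does; for any other \<open>p\<close> the right side is \<infinity>, while
    \<open>KL_div qs q0\<close> is finite.\<close>
  have lt_P: "KL_div qs q0 < KL_div p q0" if "p \<in> linear_family f pt" "p \<noteq> qs" for p
  proof (cases "\<forall>\<omega>. q0 $ \<omega> = 0 \<longrightarrow> p $ \<omega> = 0")
    case True
    have p: "p \<in> prob_simplex" "mean p f = mean qs f"
      using that(1) qs' by (auto simp: linear_family_def)
    have "0 < KL_div p qs"
      using KL_div_nonneg[OF p(1) qs'(1)] KL_div_eq_0_iff[OF p(1) qs'(1)] that(2) by (simp add: less_le)
    moreover have "KL_div p q0 = KL_div p qs + KL_div qs q0"
      using True by (intro KL_div_pythagoras(2)[OF q0 qs(1) p _ q0_in]) auto
    ultimately show ?thesis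
      using qs_fin KL_div_nonneg[OF qs'(1) q0] by (cases "KL_div p qs"; cases "KL_div qs q0") auto
  next
    case False
    then show ?thesis using KL_div_eq_infinity[of p _ q0] qs_fin by auto
  qed

  \<comment> \<open>Convergence of the iterates and of their divergences\<close>
  have q_lim: "q \<longlonglongrightarrow> qs"
  proof (rule LIMSEQ_compact_unique[OF compact_prob_simplex q])
    fix \<psi> s
    assume "strict_mono \<psi>" "(q \<circ> \<psi>) \<longlonglongrightarrow> s"
    then have s: "s \<in> exp_family_closure f q0" "s \<in> linear_family f pt" using limit by blast+
    have s': "s \<in> prob_simplex" "mean s f = mean pt f" using s by (auto simp: linear_family_def)
    \<comment> \<open>Now the identity is centred at \<open>s\<close>, which also lies in both sets:
      it makes \<open>s\<close> no worse than \<open>qs\<close>, and strict minimality of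
      \<open>qs\<close> forces equality.\<close>
    have "KL_div pt qs = KL_div pt s + KL_div s qs"
      by (rule KL_div_pythagoras(2)[OF q0 s(1) pt _ pt_ll_q0 qs(1)]) (simp add: s')
    moreover have "0 \<le> KL_div s qs" by (rule KL_div_nonneg[OF s'(1) qs'(1)])
    ultimately have "KL_div pt s \<le> KL_div pt qs" by (simp add: add_increasing2)
    then show "s = qs" using lt_Q[OF s(1)] by (meson not_le)
  qed
  have "(\<lambda>k. KL_div pt (q k)) \<longlonglongrightarrow> KL_div pt qs"
    by (rule KL_div_tendsto[OF pt q ac q_lim])
  moreover have "decseq (\<lambda>k. KL_div pt (q k))"
    using dec by (simp add: KL_q decseq_def)
  moreover have "{r. is_arg_min (\<lambda>r. KL_div pt r) (\<lambda>r. r \<in> exp_family_closure f q0) r} = {qs}"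
    unfolding is_arg_min_def using qs(1) lt_Q by (auto dest: less_asym)
  moreover have "{p. is_arg_min (\<lambda>p. KL_div p q0) (\<lambda>p. p \<in> linear_family f pt) p} = {qs}"
    unfolding is_arg_min_def using qs(2) lt_P by (auto dest: less_asym)
  ultimately show ?thesis using q_lim by blast
qed

end
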